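(* For nonnegative integers $m,n$ let $H_{m,n}(w)=\sum_{k=0}^{\min(m,n)}\binom mk\binom nk k!\,w^k$. Then, as formal power series, \begin{align*} \sum_{m,n\ge0}H_{2m,n}(u)\frac{x^m}{m!}\frac{y^n}{n!}&=e^{x+y+2uxy+u^2xy^2},\\ \sum_{m,n\ge0}H_{2m,2n}(u)\frac{x^m}{m!}\frac{y^n}{n!}&=\frac{1}{\sqrt{1-4u^2xy}}\exp\!\left(\frac{x+y+4uxy}{1-4u^2xy}\right),\\ \sum_{m\ge0}H_{m,m}(u)\frac{x^m}{m!}&=\frac{1}{1-ux}\exp\!\left(\frac{x}{1-ux}\right). \end{align*} *)

theory Defs
  imports "HOL-Computational_Algebra.Formal_Power_Series"
begin

unbundle fps_syntax

definition H :: "nat \<Rightarrow> nat \<Rightarrow> 'a::field_char_0 \<Rightarrow> 'a" where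
  "H m n w = (\<Sum>k=0..min m n. of_nat ((m choose k) * (n choose k) * fact k) * w ^ k)"

text \<open>
  The ring of bivariate formal power series in x and y over a field is represented by iterated
  power series, with x as the outer and y as the inner variable: the coefficient of
  \<open>x\<^sup>m y\<^sup>n\<close> in \<open>F\<close> is \<open>F $ m $ n\<close>.
\<close>

definition fps2 :: "(nat \<Rightarrow> nat \<Rightarrow> 'a) \<Rightarrow> 'a fps fps" where
  "fps2 c = Abs_fps (\<lambda>m. Abs_fps (\<lambda>n. c m n))"

abbreviation fps2_const :: "'a::zero \<Rightarrow> 'a fps fps" where
  "fps2_const c \<equiv> fps_const (fps_const c)"

abbreviation fps2_X :: "'a::{zero,one} fps fps" where
  "fps2_X \<equiv> fps_X"

abbreviation fps2_Y :: "'a::{zero,one} fps fps" where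
  "fps2_Y \<equiv> fps_const fps_X"

text \<open>
  Substitution of a bivariate series \<open>F\<close> with \<open>F $ 0 $ 0 = 0\<close> into a univariate series
  \<open>a\<close>, i.e. the formal sum of all \<open>a\<^sub>k F\<^sup>k\<close>.  The powers of \<open>F\<close> beyond \<open>m + n\<close> do not
  contribute to the coefficient of \<open>x\<^sup>m y\<^sup>n\<close> (see the lemma below).
  The library composition on the iterated type is of no use here: it is only meaningful if
  \<open>F $ 0 = 0\<close>, which fails for \<open>F = x + y\<close>.
\<close>

definition fps2_compose :: "'a::comm_ring_1 fps \<Rightarrow> 'a fps fps \<Rightarrow> 'a fps fps" where
  "fps2_compose a F = fps2 (\<lambda>m n. \<Sum>k=0..m + n. a $ k * (F ^ k $ m $ n))"

lemma fps2_power_nth_eq_0: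
  fixes F :: "'a::comm_ring_1 fps fps"
  assumes "F $ 0 $ 0 = 0" and "m + n < k"
  shows "F ^ k $ m $ n = 0"
  using assms(2)
proof (induction k arbitrary: m n)
  case (Suc k)
  have "F $ i $ j * F ^ k $ (m - i) $ (n - j) = 0" if "i \<le> m" "j \<le> n" for i j
  proof (cases "i = 0 \<and> j = 0")
    case False
    then have "m - i + (n - j) < k" using that Suc.prems by auto
    then show ?thesis using Suc.IH by simp
  qed (use assms(1) in simp)
  then show ?case by (simp add: fps_mult_nth fps_sum_nth)
qed simp

definition fps2_exp :: "'a::field_char_0 fps fps \<Rightarrow> 'a fps fps" where
  "fps2_exp F = fps2_compose (fps_exp 1) F"

text \<open>For \<open>F $ 0 $ 0 = 1\<close>, the square root of \<open>F\<close> with constant coefficient 1.\<close>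

definition fps2_sqrt :: "'a::field_char_0 fps fps \<Rightarrow> 'a fps fps" where
  "fps2_sqrt F = fps2_compose (fps_binomial (1 / 2)) (F - 1)"

end

theory Submission
  imports Defs
begin

text \<open>
  In the first two identities both sides are solutions of one linear differential equation in the
  outer variable \<open>x\<close>, with equal values at \<open>x = 0\<close>, hence they coincide.  For the left-hand
  sides the equation encodes a recurrence in \<open>m\<close>: the series \<open>\<Sum>\<^sub>n H\<^sub>m\<^sub>,\<^sub>n(u) y\<^sup>n / n!\<close> is multiplied
  by \<open>1 + uy\<close> when \<open>m\<close> increases by one, and \<open>Q\<^sub>m = \<Sum>\<^sub>n H\<^sub>m\<^sub>,\<^sub>2\<^sub>n(u) y\<^sup>n / n!\<close> satisfies the Hermite
  recurrence \<open>Q\<^sub>m\<^sub>+\<^sub>1 = (1 + 2uy) Q\<^sub>m + 2m u\<^sup>2 y Q\<^sub>m\<^sub>-\<^sub>1\<close>, from which the odd indices are eliminated.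
  The third identity follows by expanding \<open>(1 - ux)\<^sup>-\<^sup>k\<^sup>-\<^sup>1\<close> in each term of the exponential series.
\<close>

section \<open>Linear differential equations and inverses\<close>

text \<open>The difference of two solutions starts with 0, and comparing coefficients of
  \<open>d * h' = p * h\<close> expresses each coefficient of \<open>h\<close> through earlier ones.
  The coefficients need only form an integral domain of characteristic 0, so they may themselves be
  power series in y.\<close>

lemma fps_linear_ODE_unique:
  fixes f g :: "'a::{idom,semiring_char_0} fps"
  assumes f: "d * fps_deriv f = p * f" and g: "d * fps_deriv g = p * g"
    and d0: "d $ 0 \<noteq> 0" and init: "f $ 0 = g $ 0"
  shows "f = g"
proof -
  define h where "h = f - g"
  have ode: "d * fps_deriv h = p * h"
    using f g by (simp add: h_def algebra_simps)
  have "h $ n = 0" for n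
  proof (induction n rule: less_induct)
    case (less n)
    show ?case
    proof (cases n)
      case 0
      then show ?thesis using init by (simp add: h_def)
    next
      case (Suc k)
      \<comment> \<open>Every summand with \<open>i > 0\<close> contains some \<open>h $ j\<close>
        with \<open>j \<le> k\<close>, which is zero by induction.\<close>
      have "d $ 0 * (of_nat (Suc k) * h $ Suc k) = (\<Sum>i=0..k. d $ i * fps_deriv h $ (k - i))"
        using less Suc by (simp add: sum.atLeast_Suc_atMost del: of_nat_Suc)
      also have "\<dots> = (p * h) $ k"
        by (simp only: ode[symmetric] fps_mult_nth)
      also have "\<dots> = 0"
        using less Suc by (simp add: fps_mult_nth)
      finally show ?thesis
        using d0 Suc by (simp del: of_nat_Suc)
    qed
  qed
  then show ?thesis by (simp add: h_def fps_eq_iff)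
qed

lemma fps_mult_inverse_eq_1:
  fixes f :: "'a::field fps fps"
  assumes "f $ 0 = 1"
  shows "f * inverse f = 1"
  using fps_right_inverse[of f 1] assms by (simp add: fps_inverse_def fps_lr_inverse_one_one)

section \<open>Substitution into bivariate series and the chain rule\<close>

text \<open>Enlarging the cutoff adds only zero terms; one cutoff \<open>N\<close> shared by many
  coefficients allows finite sums to be interchanged below.\<close>

lemma fps2_compose_nth:
  assumes "F $ 0 $ 0 = 0" and "m + n \<le> N"
  shows "fps2_compose a F $ m $ n = (\<Sum>k\<le>N. a $ k * F ^ k $ m $ n)"
  unfolding fps2_compose_def fps2_def
  using assms by (auto intro!: sum.mono_neutral_left simp: fps2_power_nth_eq_0)

lemma fps2_compose_mult_nth:
  assumes "F $ 0 $ 0 = 0" and "m + n \<le> N"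
  shows "(G * fps2_compose a F) $ m $ n = (\<Sum>k\<le>N. a $ k * (G * F ^ k) $ m $ n)"
proof -
  have "(G * fps2_compose a F) $ m $ n =
      (\<Sum>i=0..m. \<Sum>j=0..n. G $ i $ j * (\<Sum>k\<le>N. a $ k * F ^ k $ (m - i) $ (n - j)))"
    using assms
    by (auto simp: fps_mult_nth fps_sum_nth fps2_compose_nth[of F _ _ N] intro!: sum.cong)
  also have "\<dots> = (\<Sum>i=0..m. \<Sum>k\<le>N. \<Sum>j=0..n. a $ k * (G $ i $ j * F ^ k $ (m - i) $ (n - j)))"
    unfolding sum_distrib_left
    by (rule sum.cong[OF refl], subst sum.swap) (simp add: mult_ac)
  also have "\<dots> = (\<Sum>k\<le>N. \<Sum>i=0..m. \<Sum>j=0..n. a $ k * (G $ i $ j * F ^ k $ (m - i) $ (n - j)))"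
    by (rule sum.swap)
  also have "\<dots> = (\<Sum>k\<le>N. a $ k * (G * F ^ k) $ m $ n)"
    by (simp add: fps_mult_nth fps_sum_nth sum_distrib_left)
  finally show ?thesis .
qed

lemma fps2_compose_deriv:
  assumes "F $ 0 $ 0 = 0"
  shows "fps_deriv (fps2_compose a F) = fps_deriv F * fps2_compose (fps_deriv a) F"
proof (intro fps_ext)
  fix m n
  have of_nat_mult: "(of_nat k * f) $ j = of_nat k * f $ j" for k j and f :: "'a fps"
    by (simp flip: fps_of_nat)
  have of_nat_mult2: "(of_nat k * f) $ i $ j = of_nat k * f $ i $ j" for k i j and f :: "'a fps fps"
    by (simp add: of_nat_mult flip: fps_of_nat)
  have power: "fps_deriv (F ^ Suc k) = of_nat (Suc k) * (fps_deriv F * F ^ k)" for k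
    by (simp add: fps_deriv_power' mult.assoc del: of_nat_Suc power_Suc)
  \<comment> \<open>The cutoff is \<open>Suc (m + n)\<close> because differentiation reads the
    coefficient at \<open>Suc m\<close>. The term \<open>k = 0\<close> is constant and drops out
    next.\<close>
  have "fps_deriv (fps2_compose a F) $ m $ n =
      (\<Sum>k\<le>Suc (m + n). a $ k * fps_deriv (F ^ k) $ m $ n)"
    using assms
    by (simp add: of_nat_mult fps2_compose_nth[where N = "Suc (m + n)"] sum_distrib_left mult_ac
        del: of_nat_Suc sum.atMost_Suc)
  also have "\<dots> = (\<Sum>k\<le>m + n. a $ Suc k * fps_deriv (F ^ Suc k) $ m $ n)"
    by (subst sum.atMost_Suc_shift) simp
  also have "\<dots> = (\<Sum>k\<le>m + n. fps_deriv a $ k * (fps_deriv F * F ^ k) $ m $ n)"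
    by (simp only: power of_nat_mult2) (simp add: mult_ac)
  also have "\<dots> = (fps_deriv F * fps2_compose (fps_deriv a) F) $ m $ n"
    by (simp add: fps2_compose_mult_nth[OF assms order_refl])
  finally show "fps_deriv (fps2_compose a F) $ m $ n =
      (fps_deriv F * fps2_compose (fps_deriv a) F) $ m $ n" .
qed

lemma fps2_exp_deriv:
  assumes "F $ 0 $ 0 = 0"
  shows "fps_deriv (fps2_exp F) = fps_deriv F * fps2_exp F"
  using fps2_compose_deriv[OF assms, of "fps_exp 1"] by (simp add: fps2_exp_def)

text \<open>Setting x = 0 is a ring homomorphism, so it commutes with powers of \<open>F\<close>;
  this gives the initial values for the differential equations.\<close>

lemma fps2_exp_nth_0: "fps2_exp F $ 0 = fps_exp 1 oo F $ 0"
  by (simp add: fps2_exp_def fps2_compose_def fps2_def fps_compose_def fps_power_zeroth)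

lemma fps2_compose_linear_nth:
  "fps2_compose a (fps_const c * fps_X) $ m = fps_const (a $ m) * c ^ m"
proof (rule fps_ext)
  fix n
  have "(fps_const c * fps_X) ^ k $ m = (if m = k then c ^ k else 0)" for k
    by (simp add: power_mult_distrib)
  then show "fps2_compose a (fps_const c * fps_X) $ m $ n = (fps_const (a $ m) * c ^ m) $ n"
    by (simp add: fps2_compose_def fps2_def if_distrib[of "\<lambda>f. f $ n"] if_distrib[of "(*) _"]
        cong: if_cong)
qed

text \<open>On coefficients this is the recurrence (m+1) b_(m+1) + m b_m = b_m / 2 for the binomial
  coefficients b_m of exponent 1/2.\<close>

lemma fps2_sqrt_linear_ODE:
  fixes c :: "'a::field_char_0 fps"
  defines "D \<equiv> 1 + fps_const c * fps_X"
  shows "2 * (D * fps_deriv (fps2_sqrt D)) = fps_const c * fps2_sqrt D"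
proof (rule fps_ext)
  fix m
  let ?b = "\<lambda>k. (1 / 2 :: 'a) gchoose k"
  have nth: "fps2_sqrt D $ k = fps_const (?b k) * c ^ k" for k
    by (simp add: fps2_sqrt_def D_def fps2_compose_linear_nth)
  have rec: "2 * (of_nat (Suc m) * ?b (Suc m) + of_nat m * ?b m) = ?b m"
    using gbinomial_mult_1[of "1/2 :: 'a" m] by (simp add: field_simps)
  have "(D * fps_deriv (fps2_sqrt D)) $ m =
      of_nat (Suc m) * fps2_sqrt D $ Suc m + c * (of_nat m * fps2_sqrt D $ m)"
    by (cases m) (simp_all add: D_def distrib_right mult.assoc)
  also have "\<dots> = fps_const (of_nat (Suc m) * ?b (Suc m) + of_nat m * ?b m) * c ^ Suc m"
    by (simp add: nth algebra_simps flip: fps_of_nat fps_const_add fps_const_mult)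
  finally have "2 * (D * fps_deriv (fps2_sqrt D)) $ m =
      fps_const (2 * (of_nat (Suc m) * ?b (Suc m) + of_nat m * ?b m)) * c ^ Suc m"
    by (simp only: numeral_fps_const mult.assoc flip: fps_const_mult)
  then have "2 * (D * fps_deriv (fps2_sqrt D)) $ m = c * fps2_sqrt D $ m"
    unfolding rec by (simp add: nth mult_ac)
  then show "(2 * (D * fps_deriv (fps2_sqrt D))) $ m = (fps_const c * fps2_sqrt D) $ m"
    by (simp add: numeral_fps_const)
qed

section \<open>Recurrences for \<open>H\<close> in each index\<close>

lemma H_commute: "H m n w = H n m w"
  by (simp add: H_def min.commute mult_ac)

lemma H_0_left [simp]: "H 0 n w = 1"
  by (simp add: H_def)

lemma H_eq_sum:
  assumes "m \<le> N"
  shows "H m n w = (\<Sum>k\<le>N. of_nat ((m choose k) * (n choose k) * fact k) * w ^ k)"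
  unfolding H_def using assms by (intro sum.mono_neutral_left) (auto simp: min_def)

text \<open>\<open>H m n w\<close> counts the matchings of the complete bipartite graph on m and n
  vertices, with weight w per edge: a new left vertex is unmatched or joined to one of n right
  vertices. The proof uses Pascal's rule and absorption. For \<open>n = 0\<close> the factor
  \<open>of_nat n\<close> cancels the truncated \<open>n - 1\<close>.\<close>

lemma H_Suc_left: "H (Suc m) n w = H m n w + of_nat n * w * H m (n - 1) w"
proof -
  have absorb: "(n choose Suc k) * fact (Suc k) = n * ((n - 1 choose k) * fact k)" for k
  proof -
    have "(n choose Suc k) * fact (Suc k) = Suc k * (n choose Suc k) * fact k"
      by (simp only: fact_Suc of_nat_id mult_ac)
    then show ?thesis by (simp only: binomial_absorption mult.assoc)
  qed
  have "H (Suc m) n w = 1 + (\<Sum>k\<le>m.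
      of_nat ((Suc m choose Suc k) * ((n choose Suc k) * fact (Suc k))) * w ^ Suc k)"
    by (subst H_eq_sum[of _ "Suc m"], simp, subst sum.atMost_Suc_shift) (simp only: mult.assoc, simp)
  also have "\<dots> = 1 + (\<Sum>k\<le>m. of_nat ((m choose Suc k) * ((n choose Suc k) * fact (Suc k))) * w ^ Suc k)
      + (\<Sum>k\<le>m. of_nat ((m choose k) * (n * ((n - 1 choose k) * fact k))) * w ^ Suc k)"
    unfolding absorb by (simp add: sum.distrib[symmetric] algebra_simps)
  also have "1 + (\<Sum>k\<le>m. of_nat ((m choose Suc k) * ((n choose Suc k) * fact (Suc k))) * w ^ Suc k)
      = H m n w"
    by (subst H_eq_sum[of _ "Suc m"], simp, subst sum.atMost_Suc_shift) (simp only: mult.assoc, simp)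
  also have "(\<Sum>k\<le>m. of_nat ((m choose k) * (n * ((n - 1 choose k) * fact k))) * w ^ Suc k)
      = of_nat n * w * H m (n - 1) w"
    by (subst H_eq_sum[of _ m]) (simp_all add: sum_distrib_left mult_ac)
  finally show ?thesis .
qed

lemma H_Suc_right: "H m (Suc n) w = H m n w + of_nat m * w * H (m - 1) n w"
  using H_Suc_left[of n m w] by (simp add: H_commute)

section \<open>Generating functions in y for fixed first index\<close>

definition H_egf :: "'a::field_char_0 \<Rightarrow> nat \<Rightarrow> 'a fps" where
  "H_egf u m = Abs_fps (\<lambda>n. H m n u / fact n)"

definition H_even_egf :: "'a::field_char_0 \<Rightarrow> nat \<Rightarrow> 'a fps" where
  "H_even_egf u m = Abs_fps (\<lambda>n. H m (2 * n) u / fact n)"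

lemma H_egf_Suc: "H_egf u (Suc m) = (1 + fps_const u * fps_X) * H_egf u m"
proof (rule fps_ext)
  fix n
  show "H_egf u (Suc m) $ n = ((1 + fps_const u * fps_X) * H_egf u m) $ n"
    by (cases n) (simp_all add: H_egf_def distrib_right mult.assoc H_Suc_left add_divide_distrib
        nonzero_divide_mult_cancel_left del: of_nat_Suc)
qed

text \<open>Raising \<open>m\<close> leads from second index 2n to the odd 2n-1; the recurrence in
  the second index returns to the even 2n-2 and produces the term in \<open>m - 1\<close>. The
  factor 2n against n! leaves 2/(n-1)!, a shift by y.\<close>

lemma H_even_egf_Suc:
  "H_even_egf u (Suc m) = (1 + 2 * fps_const u * fps_X) * H_even_egf u m
     + 2 * of_nat m * fps_const u ^ 2 * fps_X * H_even_egf u (m - 1)"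
proof (rule fps_ext)
  fix n
  have coeff: "(1 + 2 * fps_const u * fps_X) * H_even_egf u m
     + 2 * of_nat m * fps_const u ^ 2 * fps_X * H_even_egf u (m - 1)
     = H_even_egf u m + fps_const (2 * u) * (fps_X * H_even_egf u m)
     + fps_const (2 * of_nat m * u ^ 2) * (fps_X * H_even_egf u (m - 1))"
    by (simp add: algebra_simps numeral_fps_const
        flip: fps_of_nat fps_const_mult fps_const_power)
  show "H_even_egf u (Suc m) $ n = ((1 + 2 * fps_const u * fps_X) * H_even_egf u m
     + 2 * of_nat m * fps_const u ^ 2 * fps_X * H_even_egf u (m - 1)) $ n"
  proof (cases n)
    case 0
    then show ?thesis unfolding coeff by (simp add: H_even_egf_def H_Suc_left)
  next
    case (Suc k)
    have "H (Suc m) (2 * n) u = H m (2 * n) u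
        + of_nat (2 * Suc k) * u * (H m (2 * k) u + of_nat m * u * H (m - 1) (2 * k) u)"
      using H_Suc_left[of m "2 * n" u] H_Suc_right[of m "2 * k" u] by (simp add: Suc)
    moreover have "of_nat (2 * Suc k) * u * x / fact (Suc k) = 2 * u * x / fact k" for x
    proof -
      have "of_nat (2 * Suc k) * u * x / fact (Suc k) =
          of_nat (Suc k) * (2 * u * x) / (of_nat (Suc k) * fact k)"
        by (simp add: algebra_simps)
      also have "\<dots> = 2 * u * x / fact k"
        by (rule mult_divide_mult_cancel_left) (simp del: of_nat_Suc)
      finally show ?thesis .
    qed
    ultimately have "H (Suc m) (2 * n) u / fact n = H m (2 * n) u / fact n
        + 2 * u * (H m (2 * k) u + of_nat m * u * H (m - 1) (2 * k) u) / fact k"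
      unfolding Suc by (simp only: add_divide_distrib)
    then show ?thesis
      unfolding coeff
      by (simp add: H_even_egf_def Suc add_divide_distrib distrib_left power2_eq_square mult_ac
          del: fact_Suc)
  qed
qed

lemma H_even_egf_Suc_Suc:
  fixes u :: "'a::field_char_0"
  defines "b \<equiv> 1 + 2 * fps_const u * fps_X" and "z \<equiv> fps_const u ^ 2 * fps_X"
  shows "H_even_egf u (Suc (Suc m)) = (b ^ 2 + 2 * of_nat (2 * m + 1) * z) * H_even_egf u m
     - 4 * of_nat (m * (m - 1)) * z ^ 2 * H_even_egf u (m - 2)"
proof (cases m)
  case 0
  then show ?thesis
    by (simp add: H_even_egf_Suc b_def z_def algebra_simps power2_eq_square)
next
  case (Suc k)
  have 1: "H_even_egf u (Suc (Suc m)) = b * H_even_egf u (Suc m)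
      + 2 * of_nat (Suc m) * z * H_even_egf u m"
    using H_even_egf_Suc[of u "Suc m"] by (simp add: b_def z_def mult_ac)
  have 2: "H_even_egf u (Suc m) = b * H_even_egf u m + 2 * of_nat m * z * H_even_egf u k"
    using H_even_egf_Suc[of u m] by (simp add: b_def z_def Suc mult_ac)
  have 3: "H_even_egf u m = b * H_even_egf u k + 2 * of_nat k * z * H_even_egf u (k - 1)"
    using H_even_egf_Suc[of u k] by (simp add: b_def z_def Suc mult_ac)
  \<comment> \<open>Here k = m-1 has the wrong parity; the recurrence one step lower trades this
    term for those of indices m and m-2.\<close>
  have 4: "b * H_even_egf u k = H_even_egf u m - 2 * of_nat k * z * H_even_egf u (k - 1)"
    using 3 by simp
  have "H_even_egf u (Suc (Suc m)) = b ^ 2 * H_even_egf u m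
      + 2 * of_nat m * z * (b * H_even_egf u k) + 2 * of_nat (Suc m) * z * H_even_egf u m"
    unfolding 1 2 by (simp only: power2_eq_square algebra_simps)
  also have "\<dots> = (b ^ 2 + 2 * (of_nat m + of_nat (Suc m)) * z) * H_even_egf u m
     - 4 * (of_nat m * of_nat k) * z ^ 2 * H_even_egf u (k - 1)"
    unfolding 4 by (simp add: power2_eq_square algebra_simps)
  finally show ?thesis by (simp add: Suc algebra_simps)
qed

section \<open>The first identity\<close>

lemma H_even_left_gf:
  fixes u :: "'a::field_char_0"
  shows "fps2 (\<lambda>m n. H (2 * m) n u / (fact m * fact n)) =
       fps2_exp (fps2_X + fps2_Y + 2 * fps2_const u * fps2_X * fps2_Y
                 + fps2_const u ^ 2 * fps2_X * fps2_Y ^ 2)"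
    (is "?L = fps2_exp ?F")
proof -
  define b :: "'a fps" where "b = 1 + fps_const u * fps_X"
  \<comment> \<open>The exponent is y + (1 + uy)^2 x, linear in x, so its x-derivative is the factor
    by which two steps of \<open>H_egf_Suc\<close> multiply a row.\<close>
  have F: "?F = fps_const fps_X + fps_const (b ^ 2) * fps_X"
    by (simp add: b_def power2_sum power2_eq_square algebra_simps numeral_fps_const
        flip: fps_const_add fps_const_mult)
  have F0: "?F $ 0 = fps_X"
    unfolding F by simp
  have "?L $ m = fps_const (1 / fact m) * H_egf u (2 * m)" for m
    by (rule fps_ext) (simp add: fps2_def H_egf_def)
  moreover have "H_egf u (2 * Suc m) = b ^ 2 * H_egf u (2 * m)" for m
    by (simp add: H_egf_Suc b_def power2_eq_square mult.assoc)
  moreover have "of_nat (Suc m) * fps_const (1 / fact (Suc m) :: 'a) = fps_const (1 / fact m)" for m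
    by (simp add: divide_simps flip: fps_of_nat del: of_nat_Suc)
  ultimately have "of_nat (Suc m) * ?L $ Suc m = b ^ 2 * ?L $ m" for m
    by (simp only: mult.assoc[symmetric]) (simp only: mult_ac)
  then have L': "fps_deriv ?L = fps_const (b ^ 2) * ?L"
    by (intro fps_ext[where 'a = "'a fps"])
      (simp only: fps_deriv_nth fps_mult_left_const_nth Suc_eq_plus1)
  show ?thesis
  proof (rule fps_linear_ODE_unique)
    show "1 * fps_deriv ?L = fps_const (b ^ 2) * ?L"
      using L' by simp
    show "1 * fps_deriv (fps2_exp ?F) = fps_const (b ^ 2) * fps2_exp ?F"
      using fps2_exp_deriv[of ?F] unfolding F by simp
    show "?L $ 0 = fps2_exp ?F $ 0"
      unfolding fps2_exp_nth_0 F0 by (rule fps_ext) (simp add: fps2_def)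
  qed simp
qed

section \<open>The second identity\<close>

lemma H_even_even_ODE:
  fixes u :: "'a::field_char_0"
  defines "L \<equiv> fps2 (\<lambda>m n. H (2 * m) (2 * n) u / (fact m * fact n))"
    and "b \<equiv> 1 + 2 * fps_const u * fps_X" and "z \<equiv> fps_const u ^ 2 * fps_X"
  defines "D \<equiv> 1 - 4 * fps_const z * fps_X"
  shows "D ^ 2 * fps_deriv L = (fps_const b ^ 2 + 2 * fps_const z * D) * L"
proof -
  have L: "L $ m = fps_const (1 / fact m) * H_even_egf u (2 * m)" for m
    by (rule fps_ext) (simp add: L_def fps2_def H_even_egf_def)
  define G where "G m = H_even_egf u (2 * m)" for m
  have G: "G m = of_nat (fact m) * L $ m" for m
    by (simp add: G_def L flip: fps_of_nat mult.assoc)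
  \<comment> \<open>This is the two-step recurrence at index 2m divided by m!, where 4 * 2m(2m-1) *
    (m-1)!/m! = 8(2m-1). At \<open>m = 0\<close> the truncated \<open>2 * m - 1\<close> is 0, so the
    last term vanishes.\<close>
  have rec: "of_nat (Suc m) * L $ Suc m = (b ^ 2 + 2 * of_nat (4 * m + 1) * z) * L $ m
     - 8 * of_nat (2 * m - 1) * z ^ 2 * L $ (m - 1)" (is "?l = ?r") for m
  proof -
    have "fact m * ?l = fact m * ?r"
    proof (cases m)
      case 0
      then show ?thesis
        using G[of 0] G[of 1] H_even_egf_Suc_Suc[of u 0] by (simp add: G_def b_def z_def numeral_2_eq_2)
    next
      case (Suc k)
      have "G (Suc m) = (b ^ 2 + 2 * of_nat (4 * m + 1) * z) * G m
          - 4 * of_nat (2 * m * (2 * m - 1)) * z ^ 2 * G k"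
        using H_even_egf_Suc_Suc[of u "2 * m"] by (simp add: G_def b_def z_def Suc)
      then show ?thesis
        unfolding G by (simp add: Suc algebra_simps)
    qed
    then show ?thesis by simp
  qed
  \<comment> \<open>A factor m becomes x d/dx, and 2m-1 = 2(m-1)+1 gives
    \<open>2 * (x * L') + L\<close> shifted by x. Collecting terms, \<open>L'\<close> receives 1 -
    8zx + 16z^2x^2 = D^2 and \<open>L\<close> receives b^2 + 2z - 8z^2x = b^2 + 2zD.\<close>
  have "fps_deriv L = fps_const (b ^ 2 + 2 * z) * L + fps_const (8 * z) * (fps_X * fps_deriv L)
      - fps_const (8 * z ^ 2) * (fps_X * (fps_const 2 * (fps_X * fps_deriv L) + L))"
  proof (rule fps_ext)
    fix m
    show "fps_deriv L $ m = (fps_const (b ^ 2 + 2 * z) * L + fps_const (8 * z) * (fps_X * fps_deriv L)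
      - fps_const (8 * z ^ 2) * (fps_X * (fps_const 2 * (fps_X * fps_deriv L) + L))) $ m"
      using rec[of m] by (cases m) (auto simp: algebra_simps)
  qed
  also have "\<dots> = (fps_const b ^ 2 + 2 * fps_const z) * L + 8 * fps_const z * (fps_X * fps_deriv L)
      - 8 * fps_const z ^ 2 * (fps_X * (2 * (fps_X * fps_deriv L) + L))"
    by (simp add: numeral_fps_const)
  finally show ?thesis
    by (simp add: D_def power2_eq_square algebra_simps flip: fps_const_mult)
qed

text \<open>Write the right-hand side as \<open>T * E\<close> with T = 1/sqrt(D) and E = exp(N/D).
  Then D T' = 2zT and D^2 (N/D)' = b^2, so the product rule yields the equation of
  \<open>H_even_even_ODE\<close>.\<close>

lemma H_even_even_gf:
  fixes u :: "'a::field_char_0"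
  shows "fps2 (\<lambda>m n. H (2 * m) (2 * n) u / (fact m * fact n)) =
       1 / fps2_sqrt (1 - 4 * fps2_const u ^ 2 * fps2_X * fps2_Y) *
       fps2_exp ((fps2_X + fps2_Y + 4 * fps2_const u * fps2_X * fps2_Y) /
                 (1 - 4 * fps2_const u ^ 2 * fps2_X * fps2_Y))"
    (is "?L = 1 / fps2_sqrt ?D * fps2_exp (?N / ?D)")
proof -
  define z :: "'a fps" where "z = fps_const u ^ 2 * fps_X"
  define b :: "'a fps" where "b = 1 + 2 * fps_const u * fps_X"
  define D where "D = ?D"
  define S where "S = fps2_sqrt D"
  define T where "T = inverse S"
  define F where "F = ?N * inverse D"
  define E where "E = fps2_exp F"
  have D: "D = 1 - 4 * fps_const z * fps_X"
    by (simp add: D_def z_def algebra_simps flip: fps_const_mult fps_const_power)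
  then have D_linear: "D = 1 + fps_const (- 4 * z) * fps_X"
    by (simp add: numeral_fps_const flip: fps_const_neg)
  have D0: "D $ 0 = 1"
    by (simp add: D)
  have S0: "S $ 0 = 1"
    by (simp add: S_def fps2_sqrt_def D_linear fps2_compose_linear_nth)
  have DI: "D * inverse D = 1" and ST: "S * T = 1"
    using D0 S0 by (simp_all add: T_def fps_mult_inverse_eq_1)
  have "subdegree D = 0" "subdegree S = 0"
    using D0 S0 by (simp_all add: subdegree_eq_0)
  then have R: "1 / fps2_sqrt ?D * fps2_exp (?N / ?D) = T * E"
    unfolding D_def[symmetric] by (simp add: fps_divide_unit' E_def F_def T_def flip: S_def)
  have F0: "F $ 0 = fps_X"
    by (simp add: F_def D0)
  have "2 * (D * fps_deriv S) = fps_const (- 4 * z) * S"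
    using fps2_sqrt_linear_ODE[of "- 4 * z"] unfolding S_def D_linear .
  then have S': "2 * (D * fps_deriv S) = - 4 * fps_const z * S"
    by (simp add: numeral_fps_const flip: fps_const_neg)
  have T': "D * fps_deriv T = 2 * fps_const z * T"
  proof -
    have "S * fps_deriv T + fps_deriv S * T = 0"
      using arg_cong[OF ST, of fps_deriv] by simp
    \<comment> \<open>The factor \<open>2 * D * T\<close> creates
      \<open>2 * (D * fps_deriv S)\<close>, which \<open>S'\<close> replaces by a multiple of
      \<open>S\<close>, and then \<open>S * T\<close> collapses to 1.\<close>
    then have "2 * D * T * (S * fps_deriv T + fps_deriv S * T) = 0"
      by simp
    then have "2 * D * (S * T) * fps_deriv T + (2 * (D * fps_deriv S)) * T * T = 0"
      by (simp add: algebra_simps)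
    then have "2 * D * (S * T) * fps_deriv T + (- 4 * fps_const z * (S * T)) * T = 0"
      unfolding S' by (simp add: algebra_simps)
    then have "2 * (D * fps_deriv T) = 2 * (2 * fps_const z * T)"
      by (simp add: ST mult.assoc)
    then show ?thesis by (simp only: mult_cancel_left) simp
  qed
  have F': "D ^ 2 * fps_deriv F = fps_const b ^ 2"
  proof -
    have DF: "D * F = ?N"
      using DI by (simp add: F_def mult.left_commute)
    have "D * fps_deriv F + fps_deriv D * F = fps_deriv ?N"
      using arg_cong[OF DF, of fps_deriv] by simp
    then have "D * (D * fps_deriv F + fps_deriv D * F) = D * fps_deriv ?N"
      by simp
    then have "D ^ 2 * fps_deriv F = D * fps_deriv ?N - fps_deriv D * ?N"
      unfolding DF[symmetric] by (simp add: power2_eq_square algebra_simps)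
    also have "fps_deriv ?N = 1 + 4 * fps2_const u * fps2_Y"
      by (simp add: numeral_fps_const)
    also have "fps_deriv D = - (4 * fps2_const u ^ 2 * fps2_Y)"
      by (simp add: D_def numeral_fps_const)
    \<comment> \<open>In the numerator of the quotient rule all terms containing x cancel.\<close>
    also have "D * (1 + 4 * fps2_const u * fps2_Y) - - (4 * fps2_const u ^ 2 * fps2_Y) * ?N
        = (1 + 2 * fps2_const u * fps2_Y) ^ 2"
      unfolding D_def by algebra
    also have "1 + 2 * fps2_const u * fps2_Y = fps_const b"
      by (simp add: b_def numeral_fps_const flip: fps_const_add fps_const_mult)
    finally show ?thesis .
  qed
  have E': "fps_deriv E = fps_deriv F * E"
    using F0 by (simp add: E_def fps2_exp_deriv)
  show ?thesis
    unfolding R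
  proof (rule fps_linear_ODE_unique)
    show "D ^ 2 * fps_deriv ?L = (fps_const b ^ 2 + 2 * fps_const z * D) * ?L"
      using H_even_even_ODE[of u] by (simp only: b_def z_def D)
    have "D ^ 2 * fps_deriv (T * E) = (D ^ 2 * fps_deriv F) * (T * E) + D * (D * fps_deriv T) * E"
      by (simp add: E' power2_eq_square algebra_simps)
    also have "\<dots> = (fps_const b ^ 2 + 2 * fps_const z * D) * (T * E)"
      unfolding F' T' by (simp add: algebra_simps)
    finally show "D ^ 2 * fps_deriv (T * E) = (fps_const b ^ 2 + 2 * fps_const z * D) * (T * E)" .
    show "(D ^ 2) $ 0 \<noteq> 0"
      by (simp add: fps_power_zeroth D0)
    have "T $ 0 = 1" "E $ 0 = fps_exp 1"
      by (simp_all add: T_def S0 E_def fps2_exp_nth_0 F0)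
    then show "?L $ 0 = (T * E) $ 0"
      by (intro fps_ext) (simp add: fps2_def)
  qed
qed

section \<open>The third identity\<close>

lemma fps_mult_compose_nth:
  fixes g h :: "'a::comm_ring_1 fps"
  assumes "g $ 0 = 0"
  shows "(h * (a oo g)) $ m = (\<Sum>k\<le>m. a $ k * (h * g ^ k) $ m)"
proof -
  have "(a oo g) $ j = (\<Sum>k\<le>m. a $ k * g ^ k $ j)" if "j \<le> m" for j
    unfolding fps_compose_nth using that assms
    by (intro sum.mono_neutral_left) (auto simp: startsby_zero_power_prefix)
  then have "(h * (a oo g)) $ m = (\<Sum>i=0..m. \<Sum>k\<le>m. a $ k * (h $ i * g ^ k $ (m - i)))"
    by (simp add: fps_mult_nth sum_distrib_left mult_ac)
  also have "\<dots> = (\<Sum>k\<le>m. a $ k * (h * g ^ k) $ m)"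
    by (subst sum.swap) (simp add: fps_mult_nth sum_distrib_left)
  finally show ?thesis .
qed

lemma H_diag_gf:
  fixes u :: "'a::field_char_0"
  shows "Abs_fps (\<lambda>m. H m m u / fact m) =
       1 / (1 - fps_const u * fps_X) * (fps_exp 1 oo (fps_X / (1 - fps_const u * fps_X)))"
proof (rule fps_ext)
  fix m
  define I where "I = inverse (1 - fps_const u * fps_X)"
  \<comment> \<open>Negative binomial series; the exponent is \<open>Suc k\<close> because the
    prefactor \<open>I\<close> joins the \<open>k\<close> copies from the power of
    \<open>fps_X * I\<close>.\<close>
  have I: "I ^ Suc k $ j = of_nat ((k + j) choose j) * u ^ j" for k j
    unfolding I_def fps_inverse_power[symmetric]
    by (subst one_minus_const_fps_X_neg_power') simp_all
  have div: "f / (1 - fps_const u * fps_X) = f * I" for f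
    unfolding I_def by (rule fps_divide_unit) simp
  have "(1 / (1 - fps_const u * fps_X) * (fps_exp 1 oo (fps_X / (1 - fps_const u * fps_X)))) $ m
      = (\<Sum>k\<le>m. 1 / fact k * (I * (fps_X * I) ^ k) $ m)"
    unfolding div by (simp add: fps_mult_compose_nth)
  also have "\<dots> = (\<Sum>k\<le>m. 1 / fact k * (of_nat (m choose (m - k)) * u ^ (m - k)))"
  proof (rule sum.cong)
    fix k assume "k \<in> {..m}"
    moreover have "I * (fps_X * I) ^ k = fps_X ^ k * I ^ Suc k"
      by (simp add: power_mult_distrib mult_ac)
    ultimately show "1 / fact k * (I * (fps_X * I) ^ k) $ m
        = 1 / fact k * (of_nat (m choose (m - k)) * u ^ (m - k))"
      by (simp add: fps_X_power_mult_nth I del: power_Suc)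
  qed simp
  \<comment> \<open>Reversing the summation matches the powers of u with those in \<open>H\<close>;
    then m!/(m-k)! = (m choose k) k! supplies the second binomial coefficient.\<close>
  also have "\<dots> = (\<Sum>k\<le>m. 1 / fact (m - k) * (of_nat (m choose k) * u ^ k))"
    by (rule sum.reindex_bij_witness[of _ "\<lambda>k. m - k" "\<lambda>k. m - k"]) auto
  also have "\<dots> = (\<Sum>k\<le>m. of_nat ((m choose k) * (m choose k) * fact k) * u ^ k / fact m)"
    by (rule sum.cong) (auto simp: binomial_fact field_simps)
  also have "\<dots> = H m m u / fact m"
    by (subst H_eq_sum[of _ m]) (simp_all add: sum_divide_distrib)
  finally show "Abs_fps (\<lambda>m. H m m u / fact m) $ m =
      (1 / (1 - fps_const u * fps_X) * (fps_exp 1 oo (fps_X / (1 - fps_const u * fps_X)))) $ m"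
    by simp
qed

theorem theorem5p4:
  fixes u :: "'a::field_char_0"
  shows
    "(fps2 (\<lambda>m n. H (2 * m) n u / (fact m * fact n)) =
       fps2_exp (fps2_X + fps2_Y + 2 * fps2_const u * fps2_X * fps2_Y
                 + fps2_const u ^ 2 * fps2_X * fps2_Y ^ 2)) \<and>
    (fps2 (\<lambda>m n. H (2 * m) (2 * n) u / (fact m * fact n)) =
       1 / fps2_sqrt (1 - 4 * fps2_const u ^ 2 * fps2_X * fps2_Y) *
       fps2_exp ((fps2_X + fps2_Y + 4 * fps2_const u * fps2_X * fps2_Y) /
                 (1 - 4 * fps2_const u ^ 2 * fps2_X * fps2_Y))) \<and>
    (Abs_fps (\<lambda>m. H m m u / fact m) =
       1 / (1 - fps_const u * fps_X) *
       (fps_exp 1 oo (fps_X / (1 - fps_const u * fps_X))))"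
  using H_even_left_gf[of u] H_even_even_gf[of u] H_diag_gf[of u] by blast

end
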